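(* A metric space $M=(M;d)$ is oscillation stable if and only if it is approximately indivisible.
   Context: Metric spaces are nonempty. An isometric copy of $M$ in $M$ is a subspace of $M$ that is isometric to $M$. $M$ is oscillation stable if for every $\epsilon>0$ and every uniformly continuous and bounded function $f:M\to\mathbb{R}$ there exists an isometric copy $M^\ast$ of $M$ in $M$ with $\sup\{|f(x)-f(y)|\mid x,y\in M^\ast\}<\epsilon$. For $A\subseteq M$ and $\epsilon>0$ let $(A)_\epsilon=\{x\in M\mid \exists y\in A\ (d(x,y)<\epsilon)\}$. $M$ is approximately indivisible if for every $\epsilon>0$, every $n\in\omega$ and every function $\gamma:M\to n=\{0,1,\dots,n-1\}$ there exist $i\in n$ and an isometric copy $M^\ast$ of $M$ in $M$ with $M^\ast\subseteq(\gamma^{-1}(i))_\epsilon$. *)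

theory Defs
  imports "HOL-Analysis.Analysis"
begin

definition isometric_spaces :: "'a metric \<Rightarrow> 'b metric \<Rightarrow> bool" where
  "isometric_spaces m1 m2 \<longleftrightarrow>
     (\<exists>\<phi>. bij_betw \<phi> (mspace m1) (mspace m2) \<and>
          (\<forall>x\<in>mspace m1. \<forall>y\<in>mspace m1. mdist m2 (\<phi> x) (\<phi> y) = mdist m1 x y))"

definition isometric_copy :: "'a metric \<Rightarrow> 'a set \<Rightarrow> bool" where
  "isometric_copy m N \<longleftrightarrow> N \<subseteq> mspace m \<and> isometric_spaces m (submetric m N)"

text \<open>The supremum below is a conditionally complete one on the reals; it is the intended value
  because \<open>f\<close> is bounded and, for a nonempty space, every isometric copy is nonempty.\<close>

definition oscillation_stable :: "'a metric \<Rightarrow> bool" where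
  "oscillation_stable m \<longleftrightarrow>
     (\<forall>\<epsilon>>0. \<forall>f :: 'a \<Rightarrow> real.
        uniformly_continuous_map m euclidean_metric f \<and> bounded (f ` mspace m) \<longrightarrow>
        (\<exists>N. isometric_copy m N \<and> Sup {\<bar>f x - f y\<bar> | x y. x \<in> N \<and> y \<in> N} < \<epsilon>))"

definition nbhd :: "'a metric \<Rightarrow> 'a set \<Rightarrow> real \<Rightarrow> 'a set" where
  "nbhd m A \<epsilon> = {x \<in> mspace m. \<exists>y\<in>A. mdist m x y < \<epsilon>}"

definition approximately_indivisible :: "'a metric \<Rightarrow> bool" where
  "approximately_indivisible m \<longleftrightarrow>
     (\<forall>\<epsilon>>0. \<forall>n :: nat. \<forall>\<gamma> \<in> mspace m \<rightarrow> {..<n}.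
        \<exists>i<n. \<exists>N. isometric_copy m N \<and> N \<subseteq> nbhd m {x \<in> mspace m. \<gamma> x = i} \<epsilon>)"

end

theory Submission
  imports Defs
begin

text \<open>
  If the space is approximately indivisible, colour it by cells of length \<open>\<epsilon>/4\<close> in the range of
  a bounded uniformly continuous \<open>f\<close>: on a copy close to a single colour class, \<open>f\<close> varies by
  at most \<open>3\<epsilon>/4\<close>.

  Conversely, induct on the number of colours. Given a colour class \<open>A\<close>, take a copy on which
  \<open>min \<epsilon> (d(\<cdot>, A))\<close> oscillates by less than \<open>\<epsilon>\<close>. Either the copy lies in the
  \<open>\<epsilon>\<close>-neighbourhood of \<open>A\<close>, or it misses \<open>A\<close> and so carries one colour fewer; in the latter
  case pull the colouring back along the isometry and use the induction hypothesis.
\<close>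

text \<open>A distance-preserving map is injective, so bijectivity onto the image comes for free. In
  this form copies can be composed and colourings pulled back.\<close>

lemma isometric_copy_iff_image:
  "isometric_copy m N \<longleftrightarrow>
     (\<exists>\<phi>. \<phi> \<in> mspace m \<rightarrow> mspace m \<and> N = \<phi> ` mspace m \<and>
          (\<forall>x\<in>mspace m. \<forall>y\<in>mspace m. mdist m (\<phi> x) (\<phi> y) = mdist m x y))"
  (is "?L \<longleftrightarrow> ?R")
proof
  assume ?L
  then obtain \<phi> where N: "N \<subseteq> mspace m" and "bij_betw \<phi> (mspace m) (mspace (submetric m N))"
    and iso: "\<forall>x\<in>mspace m. \<forall>y\<in>mspace m. mdist m (\<phi> x) (\<phi> y) = mdist m x y"
    by (auto simp: isometric_copy_def isometric_spaces_def)
  then have "\<phi> ` mspace m = N"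
    by (auto simp: bij_betw_def)
  then show ?R
    using N iso by blast
next
  assume ?R
  then obtain \<phi> where \<phi>: "\<phi> \<in> mspace m \<rightarrow> mspace m" and N: "N = \<phi> ` mspace m"
    and iso: "\<forall>x\<in>mspace m. \<forall>y\<in>mspace m. mdist m (\<phi> x) (\<phi> y) = mdist m x y"
    by blast
  have sub: "N \<subseteq> mspace m"
    using \<phi> N by auto
  have "inj_on \<phi> (mspace m)"
  proof (rule inj_onI)
    fix x y assume xy: "x \<in> mspace m" "y \<in> mspace m" "\<phi> x = \<phi> y"
    then have "mdist m (\<phi> x) (\<phi> y) = 0"
      using \<phi> by (simp add: Pi_iff)
    then have "mdist m x y = 0"
      using iso xy(1,2) by metis
    then show "x = y"
      using xy(1,2) by simp
  qed
  then have "bij_betw \<phi> (mspace m) (mspace (submetric m N))"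
    using N sub by (simp add: bij_betw_def Int_absorb2)
  then show ?L
    using sub iso by (auto simp: isometric_copy_def isometric_spaces_def)
qed

lemma isometric_copy_mspace: "isometric_copy m (mspace m)"
  unfolding isometric_copy_iff_image by (rule exI[of _ id]) auto

text \<open>Self-isometries compose: this transports a copy found for a pulled-back colouring to one
  for the original colouring.\<close>

lemma isometric_copy_image:
  assumes "isometric_copy m N" "\<phi> \<in> mspace m \<rightarrow> mspace m"
    and "\<And>x y. x \<in> mspace m \<Longrightarrow> y \<in> mspace m \<Longrightarrow> mdist m (\<phi> x) (\<phi> y) = mdist m x y"
  shows "isometric_copy m (\<phi> ` N)"
proof -
  obtain \<psi> where "\<psi> \<in> mspace m \<rightarrow> mspace m" "N = \<psi> ` mspace m"
    "\<forall>x\<in>mspace m. \<forall>y\<in>mspace m. mdist m (\<psi> x) (\<psi> y) = mdist m x y"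
    using assms(1) unfolding isometric_copy_iff_image by blast
  then show ?thesis
    unfolding isometric_copy_iff_image using assms(2,3)
    by (intro exI[of _ "\<phi> \<circ> \<psi>"]) (auto simp: Pi_iff)
qed

lemma isometric_copy_nonempty:
  "isometric_copy m N \<Longrightarrow> mspace m \<noteq> {} \<Longrightarrow> N \<noteq> {}"
  by (auto simp: isometric_copy_iff_image)

lemma INF_mdist_le:
  assumes "A \<subseteq> mspace m" "x \<in> mspace m" "a \<in> A"
  shows "(INF a\<in>A. mdist m x a) \<le> mdist m x a"
  using assms by (intro cINF_lower bdd_belowI[of _ 0]) auto

lemma INF_mdist_nonneg:
  assumes "A \<noteq> {}"
  shows "0 \<le> (INF a\<in>A. mdist m x a)"
  using assms by (intro cINF_greatest) auto

text \<open>Take the infimum over \<open>a\<close> in the triangle inequality. With \<open>x\<close>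
  and \<open>y\<close> exchanged, this makes the distance to \<open>A\<close> 1-Lipschitz.\<close>

lemma INF_mdist_triangle:
  assumes "A \<subseteq> mspace m" "A \<noteq> {}" "x \<in> mspace m" "y \<in> mspace m"
  shows "(INF a\<in>A. mdist m x a) \<le> mdist m x y + (INF a\<in>A. mdist m y a)"
proof -
  have "(INF a\<in>A. mdist m x a) - mdist m x y \<le> (INF a\<in>A. mdist m y a)"
  proof (rule cINF_greatest)
    fix a assume "a \<in> A"
    then show "(INF a\<in>A. mdist m x a) - mdist m x y \<le> mdist m y a"
      using INF_mdist_le[of A m x a] mdist_triangle[of x m y a] assms by auto
  qed (use assms in auto)
  then show ?thesis
    by simp
qed

text \<open>Truncating at \<epsilon> keeps the 1-Lipschitz bound, so \<delta> = \<open>e\<close>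
  works. The truncation is there to keep the function bounded when the space is not.\<close>

lemma uniformly_continuous_map_min_INF_mdist:
  assumes "A \<subseteq> mspace m" "A \<noteq> {}"
  shows "uniformly_continuous_map m euclidean_metric (\<lambda>x. min \<epsilon> (INF a\<in>A. mdist m x a))"
  unfolding uniformly_continuous_map_def
proof (intro conjI allI impI)
  fix e :: real assume "e > 0"
  have "dist (min \<epsilon> (INF a\<in>A. mdist m y a)) (min \<epsilon> (INF a\<in>A. mdist m x a)) < e"
    if "x \<in> mspace m" "y \<in> mspace m" "mdist m y x < e" for x y
    using INF_mdist_triangle[OF assms that(1,2)] INF_mdist_triangle[OF assms that(2,1)]
      that(3) mdist_commute[of m x y]
    by (auto simp: dist_real_def min_def)
  then show "\<exists>\<delta>>0. \<forall>x\<in>mspace m. \<forall>y\<in>mspace m. mdist m y x < \<delta> \<longrightarrow>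
      mdist euclidean_metric (min \<epsilon> (INF a\<in>A. mdist m y a)) (min \<epsilon> (INF a\<in>A. mdist m x a)) < e"
    using \<open>e > 0\<close> by auto
qed auto

lemma oscillation_stable_copy_near_or_disjoint:
  assumes os: "oscillation_stable m" and A: "A \<subseteq> mspace m" and "\<epsilon> > 0"
  obtains N where "isometric_copy m N" "N \<subseteq> nbhd m A \<epsilon> \<or> N \<inter> A = {}"
proof (cases "A = {}")
  \<comment> \<open>The infimum over an empty set carries no information; here the whole space is a
    copy disjoint from \<open>A\<close>.\<close>
  case True
  then show ?thesis
    using that isometric_copy_mspace by blast
next
  case False
  define f where "f = (\<lambda>x. min \<epsilon> (INF a\<in>A. mdist m x a))"
  have f_range: "0 \<le> f x" "f x \<le> \<epsilon>" for x
    using INF_mdist_nonneg[OF False] \<open>\<epsilon> > 0\<close> by (auto simp: f_def)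
  have "bounded (f ` mspace m)"
    using f_range by (intro boundedI[of _ \<epsilon>]) auto
  moreover have "uniformly_continuous_map m euclidean_metric f"
    unfolding f_def by (rule uniformly_continuous_map_min_INF_mdist[OF A False])
  ultimately obtain N where N: "isometric_copy m N"
    and osc: "Sup {\<bar>f x - f y\<bar> | x y. x \<in> N \<and> y \<in> N} < \<epsilon>"
    using os \<open>\<epsilon> > 0\<close> unfolding oscillation_stable_def by blast
  \<comment> \<open>Only for a set bounded above does the conditional supremum bound each single
    difference.\<close>
  have "bdd_above {\<bar>f x - f y\<bar> | x y. x \<in> N \<and> y \<in> N}"
  proof (rule bdd_aboveI)
    fix z assume "z \<in> {\<bar>f x - f y\<bar> | x y. x \<in> N \<and> y \<in> N}"
    then obtain x y where "z = \<bar>f x - f y\<bar>" by blast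
    then show "z \<le> \<epsilon>"
      using f_range[of x] f_range[of y] by linarith
  qed
  then have diff: "\<bar>f x - f y\<bar> < \<epsilon>" if "x \<in> N" "y \<in> N" for x y
    using that osc by (intro le_less_trans[OF cSup_upper osc]) auto
  have NM: "N \<subseteq> mspace m"
    using N by (simp add: isometric_copy_def)
  \<comment> \<open>If the copy meets \<open>A\<close>, then \<open>f\<close> vanishes somewhere on
    it and so stays below \<epsilon> on all of it. There the truncation is inactive, and
    \<open>f\<close> is the true distance to \<open>A\<close>.\<close>
  have "N \<subseteq> nbhd m A \<epsilon>" if "a \<in> N" "a \<in> A" for a
  proof
    fix x assume x: "x \<in> N"
    have aM: "a \<in> mspace m"
      using A \<open>a \<in> A\<close> by blast
    have "f a = 0"
      using INF_mdist_le[OF A aM \<open>a \<in> A\<close>] f_range(1)[of a]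
        mdist_zero[OF aM aM, THEN iffD2, OF refl]
      unfolding f_def by linarith
    then have "f x < \<epsilon>"
      using diff[OF x \<open>a \<in> N\<close>] by linarith
    then have "(INF a\<in>A. mdist m x a) < \<epsilon>"
      by (simp add: f_def min_def split: if_splits)
    then obtain b where "b \<in> A" "mdist m x b < \<epsilon>"
      using False cInf_lessD[of "mdist m x ` A" \<epsilon>] by blast
    then show "x \<in> nbhd m A \<epsilon>"
      using x NM by (auto simp: nbhd_def)
  qed
  then show ?thesis
    using that[OF N] by blast
qed

text \<open>Colours range over an arbitrary finite set, so that any one of them can be removed in
  the induction; the colouring must vary too, since it is replaced by its pullback.\<close>

lemma oscillation_stable_imp_copy_near_colour:
  assumes os: "oscillation_stable m" and "mspace m \<noteq> {}" and "\<epsilon> > 0"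
    and "finite C" "\<gamma> \<in> mspace m \<rightarrow> C"
  shows "\<exists>i\<in>C. \<exists>N. isometric_copy m N \<and> N \<subseteq> nbhd m {x \<in> mspace m. \<gamma> x = i} \<epsilon>"
  using assms(4,5)
proof (induction C arbitrary: \<gamma> rule: finite_induct)
  case empty
  then show ?case
    \<comment> \<open>A nonempty space has no colouring without colours.\<close>
    using assms(2) by auto
next
  case (insert c C)
  obtain N where N: "isometric_copy m N"
    and alt: "N \<subseteq> nbhd m {x \<in> mspace m. \<gamma> x = c} \<epsilon> \<or> N \<inter> {x \<in> mspace m. \<gamma> x = c} = {}"
    using oscillation_stable_copy_near_or_disjoint[OF os _ \<open>\<epsilon> > 0\<close>, of "{x \<in> mspace m. \<gamma> x = c}"]
    by auto
  show ?case
  proof (cases "N \<subseteq> nbhd m {x \<in> mspace m. \<gamma> x = c} \<epsilon>")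
    case True
    then show ?thesis
      using N by blast
  next
    case False
    then have disj: "N \<inter> {x \<in> mspace m. \<gamma> x = c} = {}"
      using alt by blast
    obtain \<phi> where \<phi>: "\<phi> \<in> mspace m \<rightarrow> mspace m" "N = \<phi> ` mspace m"
      and iso: "\<And>x y. x \<in> mspace m \<Longrightarrow> y \<in> mspace m \<Longrightarrow> mdist m (\<phi> x) (\<phi> y) = mdist m x y"
      using N unfolding isometric_copy_iff_image by blast
    \<comment> \<open>The image of \<open>\<phi>\<close> is \<open>N\<close>, which misses colour
      \<open>c\<close>.\<close>
    have "\<gamma> \<circ> \<phi> \<in> mspace m \<rightarrow> C"
      using \<phi> disj insert.prems by (fastforce simp: Pi_iff)
    then obtain i N' where i: "i \<in> C" and N': "isometric_copy m N'"
      and near: "N' \<subseteq> nbhd m {x \<in> mspace m. (\<gamma> \<circ> \<phi>) x = i} \<epsilon>"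
      using insert.IH by blast
    have "\<phi> ` N' \<subseteq> nbhd m {x \<in> mspace m. \<gamma> x = i} \<epsilon>"
    proof
      fix z assume "z \<in> \<phi> ` N'"
      then obtain x y where "z = \<phi> x" "x \<in> mspace m" "y \<in> mspace m" "\<gamma> (\<phi> y) = i"
        "mdist m x y < \<epsilon>"
        using near by (auto simp: nbhd_def)
      then show "z \<in> nbhd m {x \<in> mspace m. \<gamma> x = i} \<epsilon>"
        using \<phi>(1) iso unfolding nbhd_def by (auto intro!: bexI[of _ "\<phi> y"])
    qed
    then show ?thesis
      using i isometric_copy_image[OF N' \<phi>(1) iso] by blast
  qed
qed

lemma oscillation_stable_imp_approximately_indivisible:
  assumes "mspace m \<noteq> {}" "oscillation_stable m"
  shows "approximately_indivisible m"
  unfolding approximately_indivisible_def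
  using oscillation_stable_imp_copy_near_colour[OF assms(2,1) _ finite_lessThan]
  by (metis lessThan_iff)

lemma approximately_indivisible_imp_oscillation_stable:
  assumes ne: "mspace m \<noteq> {}" and ai: "approximately_indivisible m"
  shows "oscillation_stable m"
  unfolding oscillation_stable_def
proof (intro allI impI, elim conjE)
  fix \<epsilon> :: real and f :: "'a \<Rightarrow> real"
  assume "\<epsilon> > 0" and uc: "uniformly_continuous_map m euclidean_metric f"
    and "bounded (f ` mspace m)"
  then obtain B where B: "\<And>x. x \<in> mspace m \<Longrightarrow> \<bar>f x\<bar> \<le> B"
    unfolding bounded_iff by auto
  \<comment> \<open>The final bound is \<open>3 * \<eta>\<close>, which must be strictly less than
    \<epsilon>.\<close>
  define \<eta> where "\<eta> = \<epsilon> / 4"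
  have "\<eta> > 0"
    using \<open>\<epsilon> > 0\<close> by (simp add: \<eta>_def)
  obtain \<delta> where "\<delta> > 0" and \<delta>: "\<And>x y. x \<in> mspace m \<Longrightarrow> y \<in> mspace m \<Longrightarrow> mdist m y x < \<delta> \<Longrightarrow>
      \<bar>f y - f x\<bar> < \<eta>"
    using uc \<open>\<eta> > 0\<close> unfolding uniformly_continuous_map_def mdist_euclidean_metric dist_real_def
    by blast
  \<comment> \<open>Adding \<open>B\<close> makes the quotient nonnegative on the space, so
    \<open>nat\<close> loses nothing.\<close>
  define \<gamma> where "\<gamma> = (\<lambda>x. nat \<lfloor>(f x + B) / \<eta>\<rfloor>)"
  have cell: "real (\<gamma> x) \<le> (f x + B) / \<eta>" "(f x + B) / \<eta> < real (\<gamma> x) + 1"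
    if "x \<in> mspace m" for x
  proof -
    have "0 \<le> (f x + B) / \<eta>"
      using B[OF that] \<open>\<eta> > 0\<close> by auto
    then show "real (\<gamma> x) \<le> (f x + B) / \<eta>" "(f x + B) / \<eta> < real (\<gamma> x) + 1"
      unfolding \<gamma>_def by linarith+
  qed
  have same_cell: "\<bar>f x - f y\<bar> \<le> \<eta>" if "x \<in> mspace m" "y \<in> mspace m" "\<gamma> x = \<gamma> y" for x y
  proof -
    have "\<bar>(f x + B) / \<eta> - (f y + B) / \<eta>\<bar> \<le> 1"
      using cell[OF that(1)] cell[OF that(2)] that(3) by linarith
    then have "\<bar>(f x - f y) / \<eta>\<bar> \<le> 1"
      by (simp add: diff_divide_distrib add_divide_distrib)
    then show ?thesis
      using \<open>\<eta> > 0\<close> by (simp add: abs_divide)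
  qed
  \<comment> \<open>\<open>Suc\<close> admits the top cell, which is reached when
    \<open>f x = B\<close>.\<close>
  have "\<gamma> \<in> mspace m \<rightarrow> {..<Suc (nat \<lfloor>2 * B / \<eta>\<rfloor>)}"
  proof
    fix x assume "x \<in> mspace m"
    then have "(f x + B) / \<eta> \<le> 2 * B / \<eta>"
      using B[of x] \<open>\<eta> > 0\<close> by (intro divide_right_mono) auto
    then show "\<gamma> x \<in> {..<Suc (nat \<lfloor>2 * B / \<eta>\<rfloor>)}"
      by (auto simp: \<gamma>_def less_Suc_eq_le intro!: nat_mono floor_mono)
  qed
  then obtain i N where N: "isometric_copy m N"
    and near: "N \<subseteq> nbhd m {x \<in> mspace m. \<gamma> x = i} \<delta>"
    using ai \<open>\<delta> > 0\<close> unfolding approximately_indivisible_def by blast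
  \<comment> \<open>Pass from \<open>x\<close> to a nearby \<open>x'\<close> of colour
    \<open>i\<close>, on to \<open>y'\<close> in the same cell, and then to \<open>y\<close>: each
    leg costs at most \<eta>.\<close>
  have "\<bar>f x - f y\<bar> \<le> 3 * \<eta>" if xy: "x \<in> N" "y \<in> N" for x y
  proof -
    have "x \<in> nbhd m {x \<in> mspace m. \<gamma> x = i} \<delta>" "y \<in> nbhd m {x \<in> mspace m. \<gamma> x = i} \<delta>"
      using near xy by auto
    then obtain x' y' where "x \<in> mspace m" "y \<in> mspace m"
      and x'y': "x' \<in> mspace m" "y' \<in> mspace m" "\<gamma> x' = i" "\<gamma> y' = i"
      and "mdist m x x' < \<delta>" "mdist m y y' < \<delta>"
      by (auto simp: nbhd_def)
    then have "\<bar>f x - f x'\<bar> < \<eta>" "\<bar>f y - f y'\<bar> < \<eta>"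
      using \<delta> by auto
    moreover have "\<bar>f x' - f y'\<bar> \<le> \<eta>"
      using same_cell x'y' by simp
    ultimately show ?thesis
      by linarith
  qed
  then have "Sup {\<bar>f x - f y\<bar> | x y. x \<in> N \<and> y \<in> N} \<le> 3 * \<eta>"
    \<comment> \<open>A uniform bound passes to the conditional supremum only if the set of
      differences is nonempty.\<close>
    using isometric_copy_nonempty[OF N ne] by (intro cSup_least) blast+
  also have "\<dots> < \<epsilon>"
    using \<open>\<epsilon> > 0\<close> by (simp add: \<eta>_def)
  finally show "\<exists>N. isometric_copy m N \<and> Sup {\<bar>f x - f y\<bar> | x y. x \<in> N \<and> y \<in> N} < \<epsilon>"
    using N by blast
qed

theorem theorem9p1:
  fixes m :: "'a metric"
  assumes "mspace m \<noteq> {}"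
  shows "oscillation_stable m \<longleftrightarrow> approximately_indivisible m"
  using oscillation_stable_imp_approximately_indivisible[OF assms]
    approximately_indivisible_imp_oscillation_stable[OF assms] by blast

end
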